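(* Let $\mathbf{H}=\mathbf{H}(a,b)$ be a quaternion algebra over a field $\mathbf{F}$, let $n\ge 1$, and let $\chi$ be a character of $S_n$. If $\mathbf{A}\in\mathbf{H}^{n\times n}$ is a Hermitian matrix, i.e. $\mathbf{A}^{*}=\mathbf{A}$, then all row immanants and all column immanants of $\mathbf{A}$ (with respect to $\chi$) coincide and lie in $\mathbf{F}$: \[ \mathrm{rImm}_{1}\mathbf{A}=\cdots=\mathrm{rImm}_{n}\mathbf{A}=\mathrm{cImm}_{1}\mathbf{A}=\cdots=\mathrm{cImm}_{n}\mathbf{A}\in\mathbf{F}. \]
   Context: Quaternion algebra: $\mathbf{H}=\mathbf{H}(a,b)$ is a central simple algebra over the field $\mathbf{F}$ that is a four-dimensional $\mathbf{F}$-vector space with basis $\{1,i,j,k\}$ and multiplication $i^2=a$, $j^2=b$, $ij=k$, $ji=-k$ with $a,b\in\mathbf{F}$ (being central simple forces $\operatorname{char}\mathbf{F}\neq 2$ and $a,b\ne 0$). It may be a division algebra or split (isomorphic to $M_2(\mathbf{F})$). $\mathbf{F}$ is identified with $\mathbf{F}\cdot 1\subset\mathbf{H}$. Conjugation is the $\mathbf{F}$-linear involution $\overline{x_0+x_1i+x_2j+x_3k}=x_0-x_1i-x_2j-x_3k$; it satisfies $\overline{xy}=\overline{y}\,\overline{x}$. For $\mathbf{A}=(a_{ij})\in\mathbf{H}^{n\times n}$, the Hermitian adjoint (conjugate transpose) $\mathbf{A}^*$ has $(i,j)$ entry $\overline{a_{ji}}$. Character: $\chi$ is a character of the symmetric group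 $S_n$ (of a finite-dimensional complex representation). It is integer-valued, and $\chi(\sigma)$ is viewed as an element of $\mathbf{F}\subset\mathbf{H}$ via the canonical map $\mathbb{Z}\to\mathbf{F}$. Row immanant: for $\mathbf{A}=(a_{ij})\in\mathbf{H}^{n\times n}$ and $1\le i\le n$, \[ \mathrm{rImm}_i\mathbf{A}=\sum_{\sigma\in S_n}\chi(\sigma)\,a_{i\,i_{k_1}}a_{i_{k_1}i_{k_1+1}}\cdots a_{i_{k_1+l_1}i}\cdots a_{i_{k_r}i_{k_r+1}}\cdots a_{i_{k_r+l_r}i_{k_r}}, \] where each $\sigma$ is written as a product of all its disjoint cycles (fixed points included as cycles of length 1, contributing a diagonal entry) in left-ordered form $\sigma=(i\,i_{k_1}i_{k_1+1}\ldots i_{k_1+l_1})(i_{k_2}i_{k_2+1}\ldots i_{k_2+l_2})\cdots(i_{k_r}i_{k_r+1}\ldots i_{k_r+l_r})$: the first cycle from the left starts with $i$, each other cycle starts with its smallest element ($i_{k_t}<i_{k_t+s}$ for $t=2,\dots,r$, $s=1,\dots,l_t$), and $i_{k_2}<i_{k_3}<\cdots<i_{k_r}$. Thus a cycle $(c_1c_2\ldots c_m)$ contributes the factor $a_{c_1c_2}a_{c_2c_3}\cdots a_{c_mc_1}$, and these factors are multiplied from left to right in the order of the cycles. Column immanant: for $1\le j\le n$, \[ \mathrm{cImm}_j\mathbf{A}=\sum_{\tau\in S_n}\chi(\tau)\,a_{j_{k_r}j_{k_r+l_r}}\cdots a_{j_{k_r+1}j_{k_r}}\cdots a_{j\,j_{k_1+l_1}}\cdots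 a_{j_{k_1+1}j_{k_1}}a_{j_{k_1}j}, \] where each $\tau$ is written in right-ordered form $\tau=(j_{k_r+l_r}\ldots j_{k_r+1}j_{k_r})\cdots(j_{k_2+l_2}\ldots j_{k_2+1}j_{k_2})(j_{k_1+l_1}\ldots j_{k_1+1}j_{k_1}j)$: the first cycle from the right has $j$ as its rightmost element, each other cycle has its smallest element rightmost ($j_{k_t}<j_{k_t+s}$ for $t=2,\dots,r$, $s=1,\dots,l_t$), and $j_{k_2}<j_{k_3}<\cdots<j_{k_r}$. Thus a cycle $(c_m\ldots c_2c_1)$ contributes the factor $a_{c_1c_m}a_{c_mc_{m-1}}\cdots a_{c_2c_1}$, and these factors are multiplied from left to right in the order of the cycles as written (so the cycle containing $j$ contributes the rightmost factor). *)

theory Defs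
  imports
    "HOL-Algebra.Sym_Groups"
    "HOL-Algebra.Ideal"
    "Jordan_Normal_Form.Matrix"
begin

section \<open>The quaternion algebra H(a,b)\<close>

text \<open>\<open>Quat x0 x1 x2 x3\<close> stands for $x_0 + x_1 i + x_2 j + x_3 k$. The vector space does not
  depend on \<open>a\<close> and \<open>b\<close>; these enter only through the multiplication \<open>qmult a b\<close>.\<close>

datatype 'f quat = Quat (q0: 'f) (q1: 'f) (q2: 'f) (q3: 'f)

instantiation quat :: (ab_group_add) ab_group_add
begin

definition zero_quat :: "'a quat" where
  "zero_quat = Quat 0 0 0 0"

definition plus_quat :: "'a quat \<Rightarrow> 'a quat \<Rightarrow> 'a quat" where
  "plus_quat x y = Quat (q0 x + q0 y) (q1 x + q1 y) (q2 x + q2 y) (q3 x + q3 y)"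

definition uminus_quat :: "'a quat \<Rightarrow> 'a quat" where
  "uminus_quat x = Quat (- q0 x) (- q1 x) (- q2 x) (- q3 x)"

definition minus_quat :: "'a quat \<Rightarrow> 'a quat \<Rightarrow> 'a quat" where
  "minus_quat x y = Quat (q0 x - q0 y) (q1 x - q1 y) (q2 x - q2 y) (q3 x - q3 y)"

instance
  by standard
    (auto simp: zero_quat_def plus_quat_def uminus_quat_def minus_quat_def algebra_simps)

end

definition of_field :: "'f::field \<Rightarrow> 'f quat" where
  "of_field c = Quat c 0 0 0"

text \<open>The bilinear extension of $i^2 = a$, $j^2 = b$, $ij = k$, $ji = -k$; the other products
  of basis elements, such as $k^2 = -ab$, are forced by associativity.\<close>

definition qmult :: "'f::field \<Rightarrow> 'f \<Rightarrow> 'f quat \<Rightarrow> 'f quat \<Rightarrow> 'f quat" where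
  "qmult a b x y = Quat
     (q0 x * q0 y + a * q1 x * q1 y + b * q2 x * q2 y - a * b * q3 x * q3 y)
     (q0 x * q1 y + q1 x * q0 y - b * q2 x * q3 y + b * q3 x * q2 y)
     (q0 x * q2 y + q2 x * q0 y + a * q1 x * q3 y - a * q3 x * q1 y)
     (q0 x * q3 y + q3 x * q0 y + q1 x * q2 y - q2 x * q1 y)"

definition qconj :: "'f::field quat \<Rightarrow> 'f quat" where
  "qconj x = Quat (q0 x) (- q1 x) (- q2 x) (- q3 x)"

definition quat_ring :: "'f::field \<Rightarrow> 'f \<Rightarrow> 'f quat ring" where
  "quat_ring a b =
     \<lparr>carrier = UNIV, mult = qmult a b, one = of_field 1, zero = 0, add = (+)\<rparr>"

lemmas quat_defs =
  zero_quat_def plus_quat_def uminus_quat_def minus_quat_def of_field_def qmult_def qconj_def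

lemma qmult_basis:
  fixes a b :: "'f::field"
  defines "qi \<equiv> Quat 0 1 0 0" and "qj \<equiv> Quat 0 0 1 0" and "qk \<equiv> Quat 0 0 0 1"
  shows "qmult a b qi qi = of_field a" "qmult a b qj qj = of_field b"
    "qmult a b qi qj = qk" "qmult a b qj qi = - qk"
    "Quat x0 x1 x2 x3 = of_field x0 + qmult a b (of_field x1) qi
       + qmult a b (of_field x2) qj + qmult a b (of_field x3) qk"
  by (simp_all add: quat_defs qi_def qj_def qk_def)

lemma qmult_assoc: "qmult a b (qmult a b x y) z = qmult a b x (qmult a b y z)"
  by (simp add: qmult_def algebra_simps)

lemma ring_quat_ring: "ring (quat_ring a b)"
proof (rule ringI)
  show "abelian_group (quat_ring a b)"
  proof (rule abelian_groupI)
    fix x assume "x \<in> carrier (quat_ring a b)"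
    show "\<exists>y\<in>carrier (quat_ring a b). y \<oplus>\<^bsub>quat_ring a b\<^esub> x = \<zero>\<^bsub>quat_ring a b\<^esub>"
      by (rule bexI[of _ "- x"]) (simp_all add: quat_ring_def)
  qed (simp_all add: quat_ring_def ac_simps)
  show "Group.monoid (quat_ring a b)"
    by (rule monoidI) (simp_all add: quat_ring_def qmult_assoc, simp_all add: quat_defs)
qed (simp_all add: quat_ring_def quat_defs algebra_simps)

text \<open>\<open>H(a,b)\<close> is called a quaternion algebra when it is central simple over the field.\<close>

definition quaternion_algebra :: "'f::field \<Rightarrow> 'f \<Rightarrow> bool" where
  "quaternion_algebra a b \<longleftrightarrow>
     {z. \<forall>x. qmult a b z x = qmult a b x z} = range of_field \<and>
     (\<forall>I. ideal I (quat_ring a b) \<longrightarrow> I = {0} \<or> I = UNIV)"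

lemma quaternion_algebra_iff:
  fixes a b :: "'f::field"
  shows "quaternion_algebra a b \<longleftrightarrow> (2::'f) \<noteq> 0 \<and> a \<noteq> 0 \<and> b \<noteq> 0"
proof
  assume Q: "quaternion_algebra a b"
  have cen: "z \<in> range of_field" if "\<And>x. qmult a b z x = qmult a b x z" for z
    using Q that unfolding quaternion_algebra_def by blast
  have sim: "I = {0} \<or> I = UNIV" if "ideal I (quat_ring a b)" for I
    using Q that unfolding quaternion_algebra_def by blast
  have idl: "ideal I (quat_ring a b)"
    if "0 \<in> I" "\<And>x y. x \<in> I \<Longrightarrow> y \<in> I \<Longrightarrow> x + y \<in> I" "\<And>x. x \<in> I \<Longrightarrow> - x \<in> I"
      "\<And>x y. x \<in> I \<Longrightarrow> qmult a b y x \<in> I" "\<And>x y. x \<in> I \<Longrightarrow> qmult a b x y \<in> I" for I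
  proof (rule idealI[OF ring_quat_ring])
    interpret ring "quat_ring a b" by (rule ring_quat_ring)
    have minv: "inv\<^bsub>add_monoid (quat_ring a b)\<^esub> x = - x" for x
    proof -
      have "\<ominus>\<^bsub>quat_ring a b\<^esub> x = - x"
        by (rule minus_equality) (simp_all add: quat_ring_def)
      thus ?thesis by (simp add: a_inv_def)
    qed
    show "subgroup I (add_monoid (quat_ring a b))"
      by (rule subgroup.intro) (use that minv in \<open>simp_all add: quat_ring_def\<close>)
  qed (use that in \<open>simp_all add: quat_ring_def\<close>)
  have "(2::'f) \<noteq> 0"
  proof
    assume 2: "(2::'f) = 0"
    have m: "- x = x" for x :: 'f
    proof -
      have "x + x = 2 * x" by simp
      hence "x + x = 0" using 2 by simp
      thus ?thesis by (simp add: add_eq_0_iff)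
    qed
    have m': "x - y = x + y" for x y :: 'f
      using m[of y] by (metis diff_conv_add_uminus)
    have "Quat 0 1 0 0 \<in> range (of_field :: 'f \<Rightarrow> _)"
      by (rule cen) (simp add: qmult_def m m')
    thus False by (auto simp: of_field_def)
  qed
  moreover have "a \<noteq> 0"
  proof
    assume a: "a = 0"
    let ?I = "{x. q0 x = 0 \<and> q2 x = 0} :: 'f quat set"
    have "ideal ?I (quat_ring a b)"
      by (rule idl) (auto simp: quat_defs a)
    from sim[OF this] show False
    proof
      assume "?I = {0}"
      moreover have "Quat 0 1 0 0 \<in> ?I" by simp
      ultimately show False by (simp add: zero_quat_def)
    next
      assume "?I = UNIV"
      hence "of_field (1::'f) \<in> ?I" by blast
      thus False by (simp add: of_field_def)
    qed
  qed
  moreover have "b \<noteq> 0"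
  proof
    assume b: "b = 0"
    let ?I = "{x. q0 x = 0 \<and> q1 x = 0} :: 'f quat set"
    have "ideal ?I (quat_ring a b)"
      by (rule idl) (auto simp: quat_defs b)
    from sim[OF this] show False
    proof
      assume "?I = {0}"
      moreover have "Quat 0 0 1 0 \<in> ?I" by simp
      ultimately show False by (simp add: zero_quat_def)
    next
      assume "?I = UNIV"
      hence "of_field (1::'f) \<in> ?I" by blast
      thus False by (simp add: of_field_def)
    qed
  qed
  ultimately show "(2::'f) \<noteq> 0 \<and> a \<noteq> 0 \<and> b \<noteq> 0" by blast
next
  assume nz: "(2::'f) \<noteq> 0 \<and> a \<noteq> 0 \<and> b \<noteq> 0"
  hence two: "x = - x \<longleftrightarrow> x = 0" for x :: 'f
    by (metis add.inverse_neutral add_eq_0_iff mult_2 mult_eq_0_iff)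
  have "z \<in> range of_field" if z: "\<And>x. qmult a b z x = qmult a b x z" for z
  proof -
    have "q2 z = - q2 z" "q3 z = - q3 z"
      using z[of "Quat 0 1 0 0"] nz
      by (simp_all add: qmult_def)
    moreover have "q1 z = - q1 z"
      using z[of "Quat 0 0 1 0"] by (simp add: qmult_def)
    ultimately have "z = of_field (q0 z)"
      unfolding two by (cases z) (simp add: of_field_def)
    thus ?thesis by blast
  qed
  moreover have "qmult a b (of_field c) x = qmult a b x (of_field c)" for c x
    by (simp add: quat_defs mult.commute)
  ultimately have "{z. \<forall>x. qmult a b z x = qmult a b x z} = range of_field" by blast
  moreover have "I = {0} \<or> I = UNIV" if I: "ideal I (quat_ring a b)" for I
  proof (rule disjCI)
    assume nU: "I \<noteq> UNIV"
    interpret ideal I "quat_ring a b" by (rule I)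
    have add: "x + y \<in> I" if "x \<in> I" "y \<in> I" for x y
      using additive_subgroup.a_closed[OF additive_subgroup_axioms that] by (simp add: quat_ring_def)
    have l: "qmult a b y x \<in> I" and r: "qmult a b x y \<in> I" if "x \<in> I" for x y
      using I_l_closed[OF that, of y] I_r_closed[OF that, of y] by (simp_all add: quat_ring_def)
    have zero: "0 \<in> I"
      using additive_subgroup.zero_closed[OF additive_subgroup_axioms] by (simp add: quat_ring_def)
    have q0: "q0 w = 0" if w: "w \<in> I" for w
    proof (rule ccontr)
      assume w0: "q0 w \<noteq> 0"
      let ?m = "qmult a b"
      let ?i = "Quat 0 1 0 0" and ?j = "Quat 0 0 1 0" and ?k = "Quat 0 0 0 1"
      let ?s = "?m (of_field (a * b)) w + ?m (of_field b) (?m ?i (?m w ?i))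
        + ?m (of_field a) (?m ?j (?m w ?j)) + ?m (of_field (- 1)) (?m ?k (?m w ?k))"
      have "?s \<in> I" by (intro add l r w)
      moreover have "?s = of_field (2 * 2 * a * b * q0 w)"
        by (simp add: quat_defs algebra_simps)
      ultimately have sI: "of_field (2 * 2 * a * b * q0 w) \<in> I" by simp
      have "x \<in> I" for x
      proof -
        define c where "c = 2 * 2 * a * b * q0 w"
        have "c \<noteq> 0"
          using nz w0 unfolding c_def by (metis mult_eq_0_iff)
        hence "?m (?m x (of_field (inverse c))) (of_field c) = x"
          by (cases x) (simp add: quat_defs)
        thus ?thesis using l[OF sI] unfolding c_def by metis
      qed
      thus False using nU by blast
    qed
    have "x = 0" if x: "x \<in> I" for x
      using q0[OF x] q0[OF r[OF x, of "Quat 0 1 0 0"]] q0[OF r[OF x, of "Quat 0 0 1 0"]]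
        q0[OF r[OF x, of "Quat 0 0 0 1"]] nz
      by (cases x) (simp add: quat_defs)
    thus "I = {0}" using zero by blast
  qed
  ultimately show "quaternion_algebra a b" unfolding quaternion_algebra_def by blast
qed

definition quat_adjoint :: "'f::field quat mat \<Rightarrow> 'f quat mat" where
  "quat_adjoint A = mat (dim_col A) (dim_row A) (\<lambda>(i, j). qconj (A $$ (j, i)))"

section \<open>Characters of the symmetric group\<close>

definition mat_trace :: "complex mat \<Rightarrow> complex" where
  "mat_trace M = (\<Sum>i<dim_row M. M $$ (i, i))"

text \<open>A representation is a homomorphism from \<open>S\<^sub>n\<close> (permutations of \<open>{1..n}\<close>) to the group of
  invertible complex $d \times d$ matrices. The values of \<open>\<chi>\<close> outside \<open>S\<^sub>n\<close> are irrelevant.\<close>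

definition sym_character :: "nat \<Rightarrow> ((nat \<Rightarrow> nat) \<Rightarrow> complex) \<Rightarrow> bool" where
  "sym_character n \<chi> \<longleftrightarrow>
     (\<exists>d. \<exists>\<rho> \<in> hom (sym_group n) (units_of (ring_mat TYPE(complex) d ())).
        \<forall>\<sigma> \<in> carrier (sym_group n). \<chi> \<sigma> = mat_trace (\<rho> \<sigma>))"

text \<open>The image in the field of a complex number that is an integer. Characters of symmetric
  groups are integer-valued, so the description denotes for their values.\<close>

definition int_to_field :: "complex \<Rightarrow> 'f::field" where
  "int_to_field z = of_int (THE m. z = of_int m)"

section \<open>Row and column immanants\<close>

text \<open>Matrix entries with indices in \<open>{1..n}\<close>; the library numbers rows and columns from 0.\<close>

definition entry :: "'h mat \<Rightarrow> nat \<Rightarrow> nat \<Rightarrow> 'h" where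
  "entry A i j = A $$ (i - 1, j - 1)"

text \<open>\<open>support \<sigma> c\<close> is the list \<open>[c, \<sigma> c, \<sigma> (\<sigma> c), ...]\<close> running once through the cycle of \<open>c\<close>.
  The smallest elements, in increasing order, of the cycles of \<open>\<sigma>\<close> that do not contain \<open>i\<close>:\<close>

definition other_leaders :: "nat \<Rightarrow> nat \<Rightarrow> (nat \<Rightarrow> nat) \<Rightarrow> nat list" where
  "other_leaders n i \<sigma> = sorted_list_of_set
     {c \<in> {1..n}. c \<notin> set (support \<sigma> i) \<and> (\<forall>d \<in> set (support \<sigma> c). c \<le> d)}"

text \<open>A cycle is written as the list \<open>[c\<^sub>1, ..., c\<^sub>m]\<close> where each element is mapped to the next and
  \<open>c\<^sub>m\<close> to \<open>c\<^sub>1\<close>. In the right-ordered form, \<open>rotate1\<close> moves the leading element of the cycle to the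
  right end.\<close>

definition left_ordered :: "nat \<Rightarrow> nat \<Rightarrow> (nat \<Rightarrow> nat) \<Rightarrow> nat list list" where
  "left_ordered n i \<sigma> = support \<sigma> i # map (support \<sigma>) (other_leaders n i \<sigma>)"

definition right_ordered :: "nat \<Rightarrow> nat \<Rightarrow> (nat \<Rightarrow> nat) \<Rightarrow> nat list list" where
  "right_ordered n j \<tau> =
     map (\<lambda>c. rotate1 (support \<tau> c)) (rev (other_leaders n j \<tau>)) @ [rotate1 (support \<tau> j)]"

text \<open>The entries contributed by a cycle: for a cycle \<open>[c\<^sub>1, c\<^sub>2, ..., c\<^sub>m]\<close> of a left-ordered form
  these are $a_{c_1c_2}, a_{c_2c_3}, \ldots, a_{c_mc_1}$; for a cycle \<open>[c\<^sub>m, ..., c\<^sub>2, c\<^sub>1]\<close> of a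
  right-ordered form $a_{c_1c_m}, a_{c_mc_{m-1}}, \ldots, a_{c_2c_1}$.\<close>

definition row_factors :: "'h mat \<Rightarrow> nat list \<Rightarrow> 'h list" where
  "row_factors A cs = map (\<lambda>(x, y). entry A x y) (zip cs (rotate1 cs))"

definition col_factors :: "'h mat \<Rightarrow> nat list \<Rightarrow> 'h list" where
  "col_factors A cs = map (\<lambda>(x, y). entry A x y) (zip (last cs # butlast cs) cs)"

definition qprod :: "'f::field \<Rightarrow> 'f \<Rightarrow> 'f quat list \<Rightarrow> 'f quat" where
  "qprod a b xs = foldr (qmult a b) xs (of_field 1)"

definition rImm ::
  "'f::field \<Rightarrow> 'f \<Rightarrow> ((nat \<Rightarrow> nat) \<Rightarrow> complex) \<Rightarrow> nat \<Rightarrow> 'f quat mat \<Rightarrow> 'f quat" where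
  "rImm a b \<chi> i A = (\<Sum>\<sigma> \<in> carrier (sym_group (dim_row A)).
     qmult a b (of_field (int_to_field (\<chi> \<sigma>)))
       (qprod a b (concat (map (row_factors A) (left_ordered (dim_row A) i \<sigma>)))))"

definition cImm ::
  "'f::field \<Rightarrow> 'f \<Rightarrow> ((nat \<Rightarrow> nat) \<Rightarrow> complex) \<Rightarrow> nat \<Rightarrow> 'f quat mat \<Rightarrow> 'f quat" where
  "cImm a b \<chi> j A = (\<Sum>\<tau> \<in> carrier (sym_group (dim_row A)).
     qmult a b (of_field (int_to_field (\<chi> \<tau>)))
       (qprod a b (concat (map (col_factors A) (right_ordered (dim_row A) j \<tau>)))))"

end

theory Submission
  imports Defs
begin

text \<open>For Hermitian $A$ the product of the entries along a reversed cycle is the conjugate of the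
  product along the cycle itself. Reversing a single cycle of $\sigma$ gives a conjugate
  permutation, so $\chi$ does not change, and averaging over the two replaces the cycle's product
  $p$ by its scalar part $(p + \overline{p})/2$. Doing this for every cycle leaves products of
  elements of the field. They do not depend on the order of the cycles, nor on where each cycle
  starts, because the scalar part satisfies $q_0(xy) = q_0(yx)$. Row and column forms contribute
  the same cycle products, only in a different order.\<close>

section \<open>Quaternion arithmetic\<close>

lemma of_field_0 [simp]: "of_field 0 = 0"
  by (simp add: quat_defs)

lemma of_field_add: "of_field (x + y) = of_field x + of_field y"
  by (simp add: quat_defs)

lemma of_field_mult: "of_field (x * y) = qmult a b (of_field x) (of_field y)"
  by (simp add: quat_defs)

lemma of_field_sum: "of_field (sum f S) = (\<Sum>x\<in>S. of_field (f x))"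
  by (induction S rule: infinite_finite_induct) (simp_all add: of_field_add)

lemma qmult_of_field_1 [simp]:
  "qmult a b (of_field 1) x = x" "qmult a b x (of_field 1) = x"
  by (simp_all add: quat_defs)

lemma qmult_add_distrib:
  "qmult a b x (y + z) = qmult a b x y + qmult a b x z"
  "qmult a b (x + y) z = qmult a b x z + qmult a b y z"
  by (simp_all add: quat_defs algebra_simps)

lemma qconj_qmult: "qconj (qmult a b x y) = qmult a b (qconj y) (qconj x)"
  by (simp add: quat_defs algebra_simps)

lemma qconj_of_field [simp]: "qconj (of_field c) = of_field c"
  by (simp add: quat_defs)

text \<open>The imaginary components cancel. The trace is kept as a sum of two equal terms, matching
  the two products paired later, so that no division by two occurs.\<close>

lemma add_qconj: "x + qconj x = of_field (q0 x) + of_field (q0 x)"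
  by (simp add: quat_defs)

lemma q0_qmult_commute: "q0 (qmult a b x y) = q0 (qmult a b y x)"
  by (simp add: quat_defs algebra_simps)

lemma q0_qconj [simp]: "q0 (qconj x) = q0 x"
  by (simp add: quat_defs)

text \<open>Doubling is injective on each coordinate when 2 is nonzero. This replaces division by
  two in the averaging argument.\<close>

lemma quat_double_eq_0:
  fixes x :: "'f::field quat"
  assumes "(2::'f) \<noteq> 0" and "x + x = 0"
  shows "x = 0"
proof -
  have "y + y = 0 \<longleftrightarrow> y = 0" for y :: 'f
    using assms(1) mult_2[of y] mult_eq_0_iff[of 2 y] by auto
  thus ?thesis
    using assms(2) by (cases x) (simp add: zero_quat_def plus_quat_def)
qed

lemma qprod_Nil [simp]: "qprod a b [] = of_field 1"
  and qprod_Cons [simp]: "qprod a b (x # xs) = qmult a b x (qprod a b xs)"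
  by (simp_all add: qprod_def)

lemma qprod_append: "qprod a b (xs @ ys) = qmult a b (qprod a b xs) (qprod a b ys)"
  by (induction xs) (simp_all add: qmult_assoc)

lemma qprod_concat: "qprod a b (concat xss) = qprod a b (map (qprod a b) xss)"
  by (induction xss) (simp_all add: qprod_append)

lemma qprod_of_field: "qprod a b (map (\<lambda>x. of_field (f x)) xs) = of_field (prod_list (map f xs))"
  by (induction xs) (simp_all add: of_field_mult[of _ _ a b])

lemma qconj_qprod: "qconj (qprod a b xs) = qprod a b (rev (map qconj xs))"
  by (induction xs) (simp_all add: qprod_append qconj_qmult)

text \<open>Moving the first factor to the end is one use of the symmetry of the scalar part, which
  is half the reduced trace.\<close>

lemma q0_qprod_rotate1: "q0 (qprod a b (rotate1 xs)) = q0 (qprod a b xs)"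
  by (cases xs) (simp_all add: qprod_append q0_qmult_commute)

section \<open>Reversing one cycle of a permutation\<close>

abbreviation orbit_set :: "('a \<Rightarrow> 'a) \<Rightarrow> 'a \<Rightarrow> 'a set" where
  "orbit_set \<sigma> k \<equiv> set (support \<sigma> k)"

lemma funpow_in_orbit_set: "permutation \<sigma> \<Longrightarrow> (\<sigma> ^^ i) k \<in> orbit_set \<sigma> k"
  by (simp only: support_set) (rule rangeI)

lemma in_orbit_setE:
  assumes "permutation \<sigma>" and "x \<in> orbit_set \<sigma> k"
  obtains i where "x = (\<sigma> ^^ i) k"
  using assms by auto

lemma self_in_orbit_set: "permutation \<sigma> \<Longrightarrow> k \<in> orbit_set \<sigma> k"
  using funpow_in_orbit_set[of \<sigma> 0] by simp

lemma support_eq_Cons: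
  assumes "permutation \<sigma>"
  shows "support \<sigma> k = k # tl (support \<sigma> k)"
proof -
  obtain m where "least_power \<sigma> k = Suc m"
    using least_power_of_permutation(2)[OF assms, of k] gr0_conv_Suc by blast
  thus ?thesis by (simp del: upt_Suc add: upt_conv_Cons)
qed

text \<open>Distinct cycles are disjoint, but \<open>x\<close> would lie on both.\<close>

lemma orbit_set_eq:
  assumes "permutation \<sigma>" and "x \<in> orbit_set \<sigma> k"
  shows "orbit_set \<sigma> x = orbit_set \<sigma> k"
proof (rule ccontr)
  assume "orbit_set \<sigma> x \<noteq> orbit_set \<sigma> k"
  hence "orbit_set \<sigma> x \<inter> orbit_set \<sigma> k = {}"
    by (rule disjointD[OF disjoint_support[OF assms(1)] rangeI rangeI])
  thus False using self_in_orbit_set[OF assms(1), of x] assms(2) by blast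
qed

lemma orbit_set_sym:
  assumes "permutation \<sigma>" and "x \<in> orbit_set \<sigma> k"
  shows "k \<in> orbit_set \<sigma> x"
  unfolding orbit_set_eq[OF assms] by (rule self_in_orbit_set[OF assms(1)])

lemma orbit_set_subset:
  assumes "\<sigma> permutes S" and "k \<in> S"
  shows "orbit_set \<sigma> k \<subseteq> S"
proof
  fix x assume "x \<in> orbit_set \<sigma> k"
  then obtain i where "x = (\<sigma> ^^ i) k" by auto
  thus "x \<in> S"
    using permutes_in_image[OF permutes_funpow[OF assms(1)], of i k] assms(2) by (simp only:)
qed

text \<open>On the cycle of \<open>k\<close> this is the reflection fixing \<open>k\<close> that
  exchanges the \<open>i\<close>-th successor of \<open>k\<close> with its \<open>i\<close>-th
  predecessor. \<open>LEAST\<close> merely selects one exponent;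
  \<open>cycle_reflection_funpow\<close> shows that every exponent gives the same value.\<close>

definition cycle_reflection :: "('a \<Rightarrow> 'a) \<Rightarrow> 'a \<Rightarrow> 'a \<Rightarrow> 'a" where
  "cycle_reflection \<sigma> k x =
     (if x \<in> orbit_set \<sigma> k then (inv' \<sigma> ^^ (LEAST i. (\<sigma> ^^ i) k = x)) k else x)"

lemma funpow_inv_cancel:
  assumes "bij \<sigma>"
  shows "(\<sigma> ^^ i) ((inv' \<sigma> ^^ i) x) = x" and "(inv' \<sigma> ^^ i) ((\<sigma> ^^ i) x) = x"
  using fun_cong[OF fn_o_inv_fn_is_id[OF assms, of i], of x]
    fun_cong[OF inv_fn_o_fn_is_id[OF assms, of i], of x] by simp_all

text \<open>If the powers \<open>i\<close> and \<open>j\<close> of \<open>\<sigma>\<close> agree at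
  \<open>k\<close>, so do the powers of the inverse: powers of \<open>\<sigma>\<close> commute, so
  the \<open>i\<close>-th power brings the \<open>j\<close>-th predecessor of \<open>k\<close> back
  to \<open>k\<close>.\<close>

lemma cycle_reflection_funpow:
  assumes "permutation \<sigma>"
  shows "cycle_reflection \<sigma> k ((\<sigma> ^^ i) k) = (inv' \<sigma> ^^ i) k"
proof -
  have b: "bij \<sigma>" using assms by (rule permutation_bijective)
  define j where "j = (LEAST j. (\<sigma> ^^ j) k = (\<sigma> ^^ i) k)"
  have j: "(\<sigma> ^^ j) k = (\<sigma> ^^ i) k"
    unfolding j_def by (rule LeastI[of _ i]) simp
  have comm: "(\<sigma> ^^ i) ((\<sigma> ^^ j) x) = (\<sigma> ^^ j) ((\<sigma> ^^ i) x)" for x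
    by (metis add.commute comp_apply funpow_add)
  have "(\<sigma> ^^ j) ((\<sigma> ^^ i) ((inv' \<sigma> ^^ j) k)) = (\<sigma> ^^ j) k"
    by (metis comm funpow_inv_cancel(1)[OF b] j)
  hence "(\<sigma> ^^ i) ((inv' \<sigma> ^^ j) k) = k"
    by (metis funpow_inv_cancel(2)[OF b])
  hence "(inv' \<sigma> ^^ j) k = (inv' \<sigma> ^^ i) k"
    by (metis funpow_inv_cancel(2)[OF b])
  thus ?thesis
    using funpow_in_orbit_set[OF assms, of i k] by (simp only: cycle_reflection_def j_def if_True)
qed

lemma cycle_reflection_outside: "x \<notin> orbit_set \<sigma> k \<Longrightarrow> cycle_reflection \<sigma> k x = x"
  by (simp only: cycle_reflection_def if_False)

lemma cycle_reflection_self: "permutation \<sigma> \<Longrightarrow> cycle_reflection \<sigma> k k = k"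
  using cycle_reflection_funpow[of \<sigma> k 0] by simp

text \<open>Going round the whole cycle returns to \<open>k\<close>. Negative powers thus become
  positions in the list \<open>support \<sigma> k\<close>.\<close>

lemma inv_funpow_eq_funpow:
  assumes "permutation \<sigma>" and "i \<le> least_power \<sigma> k"
  shows "(inv' \<sigma> ^^ i) k = (\<sigma> ^^ (least_power \<sigma> k - i)) k"
proof -
  have b: "bij \<sigma>" using assms(1) by (rule permutation_bijective)
  have "(\<sigma> ^^ i) ((\<sigma> ^^ (least_power \<sigma> k - i)) k) = k"
    using least_power_of_permutation(1)[OF assms(1), of k] assms(2)
    by (metis comp_apply funpow_add le_add_diff_inverse)
  thus ?thesis by (metis funpow_inv_cancel(2)[OF b])
qed

lemma map_cycle_reflection_support:
  assumes "permutation \<sigma>"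
  shows "map (cycle_reflection \<sigma> k) (support \<sigma> k) = k # rev (tl (support \<sigma> k))"
proof (rule nth_equalityI)
  let ?m = "least_power \<sigma> k"
  have m: "?m > 0" using least_power_of_permutation(2)[OF assms] .
  show "length (map (cycle_reflection \<sigma> k) (support \<sigma> k)) = length (k # rev (tl (support \<sigma> k)))"
    using m by simp
  fix i assume "i < length (map (cycle_reflection \<sigma> k) (support \<sigma> k))"
  hence i: "i < ?m" by simp
  have "map (cycle_reflection \<sigma> k) (support \<sigma> k) ! i = (\<sigma> ^^ (?m - i)) k"
    using i inv_funpow_eq_funpow[OF assms, of i k] cycle_reflection_funpow[OF assms, of k i] by simp
  also have "\<dots> = (k # rev (tl (support \<sigma> k))) ! i"
  proof (cases i)
    case 0
    thus ?thesis using least_power_of_permutation(1)[OF assms] by simp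
  next
    case (Suc l)
    \<comment> \<open>The tail has length \<open>?m - 1\<close> and is shifted by one against the
      full list, so position \<open>l\<close> of its reversal is position \<open>?m - i\<close> of
      the cycle.\<close>
    hence "rev (tl (support \<sigma> k)) ! l = tl (support \<sigma> k) ! (?m - 1 - Suc l)"
      using i by (subst rev_nth) simp_all
    also have "\<dots> = support \<sigma> k ! (?m - i)"
      using i Suc by (subst nth_tl) (simp_all add: Suc_diff_Suc)
    finally show ?thesis using i Suc by simp
  qed
  finally show "map (cycle_reflection \<sigma> k) (support \<sigma> k) ! i = (k # rev (tl (support \<sigma> k))) ! i" .
qed

lemma cycle_reflection_involution:
  assumes "permutation \<sigma>"
  shows "cycle_reflection \<sigma> k (cycle_reflection \<sigma> k x) = x"
proof (cases "x \<in> orbit_set \<sigma> k")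
  case True
  then obtain i where i: "x = (\<sigma> ^^ i) k" "i < least_power \<sigma> k" by auto
  have b: "bij \<sigma>" using assms by (rule permutation_bijective)
  \<comment> \<open>For \<open>i = 0\<close> this is the full cycle length, the boundary case that
    \<open>inv_funpow_eq_funpow\<close> admits.\<close>
  let ?j = "least_power \<sigma> k - i"
  have "cycle_reflection \<sigma> k x = (\<sigma> ^^ ?j) k"
    using inv_funpow_eq_funpow[OF assms, of i k] i by (simp only: cycle_reflection_funpow[OF assms])
  hence "cycle_reflection \<sigma> k (cycle_reflection \<sigma> k x) = (inv' \<sigma> ^^ ?j) k"
    by (simp only: cycle_reflection_funpow[OF assms])
  also have "\<dots> = x"
    using inv_funpow_eq_funpow[OF assms, of ?j k] i by simp
  finally show ?thesis .
qed (simp add: cycle_reflection_outside del: set_map)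

lemma cycle_reflection_permutes:
  assumes "\<sigma> permutes S" "finite S" and "k \<in> S"
  shows "cycle_reflection \<sigma> k permutes S"
proof -
  have p: "permutation \<sigma>" using assms permutation_permutes by blast
  have "cycle_reflection \<sigma> k x = x" if "x \<notin> S" for x
    using that orbit_set_subset[OF assms(1,3)] by (intro cycle_reflection_outside) blast
  thus ?thesis
    unfolding permutes_def using cycle_reflection_involution[OF p, of k] by metis
qed

text \<open>The reflection is its own inverse, so this is a conjugate of \<open>\<sigma>\<close>. It
  runs through the cycle of \<open>k\<close> backwards and leaves the other cycles alone.\<close>

definition reverse_cycle :: "('a \<Rightarrow> 'a) \<Rightarrow> 'a \<Rightarrow> 'a \<Rightarrow> 'a" where
  "reverse_cycle \<sigma> k = cycle_reflection \<sigma> k \<circ> \<sigma> \<circ> cycle_reflection \<sigma> k"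

lemma reverse_cycle_permutes:
  assumes "\<sigma> permutes S" "finite S" and "k \<in> S"
  shows "reverse_cycle \<sigma> k permutes S"
  unfolding reverse_cycle_def
  by (intro permutes_compose cycle_reflection_permutes assms)

lemma reverse_cycle_funpow:
  assumes "permutation \<sigma>"
  shows "(reverse_cycle \<sigma> k ^^ i) x = cycle_reflection \<sigma> k ((\<sigma> ^^ i) (cycle_reflection \<sigma> k x))"
  by (induction i) (simp_all add: reverse_cycle_def cycle_reflection_involution[OF assms])

lemma reverse_cycle_inv:
  assumes "permutation \<sigma>"
  shows "inv' (reverse_cycle \<sigma> k) = cycle_reflection \<sigma> k \<circ> inv' \<sigma> \<circ> cycle_reflection \<sigma> k"
proof -
  have b: "bij \<sigma>" using assms by (rule permutation_bijective)
  show ?thesis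
    by (rule inv_equality)
      (simp_all add: reverse_cycle_def cycle_reflection_involution[OF assms]
        bij_is_inj[OF b] bij_is_surj[OF b] surj_f_inv_f)
qed

lemma reverse_cycle_inv_funpow:
  assumes "permutation \<sigma>"
  shows "(inv' (reverse_cycle \<sigma> k) ^^ i) x =
    cycle_reflection \<sigma> k ((inv' \<sigma> ^^ i) (cycle_reflection \<sigma> k x))"
  unfolding reverse_cycle_inv[OF assms]
  by (induction i) (simp_all add: cycle_reflection_involution[OF assms])

text \<open>Conjugation relabels cycles. Injectivity of the reflection ensures that the cycle
  lengths agree as well.\<close>

lemma support_reverse_cycle:
  assumes "permutation \<sigma>"
  shows "support (reverse_cycle \<sigma> k) (cycle_reflection \<sigma> k x) =
    map (cycle_reflection \<sigma> k) (support \<sigma> x)"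
proof -
  have inj: "cycle_reflection \<sigma> k y = cycle_reflection \<sigma> k z \<longleftrightarrow> y = z" for y z
    using cycle_reflection_involution[OF assms] by metis
  show ?thesis
    by (simp add: least_power_def reverse_cycle_funpow[OF assms]
        cycle_reflection_involution[OF assms] inj)
qed

lemma support_reverse_cycle_self:
  assumes "permutation \<sigma>"
  shows "support (reverse_cycle \<sigma> k) k = k # rev (tl (support \<sigma> k))"
  using support_reverse_cycle[OF assms, of k k]
  unfolding cycle_reflection_self[OF assms] map_cycle_reflection_support[OF assms] .

lemma support_reverse_cycle_other:
  assumes "permutation \<sigma>" and "c \<notin> orbit_set \<sigma> k"
  shows "support (reverse_cycle \<sigma> k) c = support \<sigma> c"
proof -
  have "y \<notin> orbit_set \<sigma> k" if "y \<in> orbit_set \<sigma> c" for y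
    using that assms orbit_set_eq[OF assms(1)] orbit_set_sym[OF assms(1)] by metis
  hence "map (cycle_reflection \<sigma> k) (support \<sigma> c) = support \<sigma> c"
    by (intro map_idI cycle_reflection_outside)
  thus ?thesis
    using support_reverse_cycle[OF assms(1), of k c] cycle_reflection_outside[OF assms(2)] by metis
qed

lemma permutation_reverse_cycle:
  assumes "permutation \<sigma>"
  shows "permutation (reverse_cycle \<sigma> k)"
proof -
  obtain S where S: "finite S" "\<sigma> permutes S"
    using assms permutation_permutes by blast
  hence "\<sigma> permutes (insert k S)" by (blast intro: permutes_subset)
  hence "reverse_cycle \<sigma> k permutes (insert k S)"
    using S(1) by (intro reverse_cycle_permutes) auto
  thus ?thesis using S(1) permutation_permutes by blast
qed

text \<open>Only the order along the cycle of \<open>k\<close> changes. Everything defined from the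
  cycles as sets, in particular the choice of leaders, is therefore unaffected.\<close>

lemma orbit_set_reverse_cycle:
  assumes "permutation \<sigma>"
  shows "orbit_set (reverse_cycle \<sigma> k) c = orbit_set \<sigma> c"
proof (cases "c \<in> orbit_set \<sigma> k")
  case True
  have "set (k # rev (tl (support \<sigma> k))) = set (k # tl (support \<sigma> k))"
    by (simp only: list.set set_rev)
  hence k: "orbit_set (reverse_cycle \<sigma> k) k = orbit_set \<sigma> k"
    unfolding support_reverse_cycle_self[OF assms] support_eq_Cons[OF assms, symmetric] .
  hence "c \<in> orbit_set (reverse_cycle \<sigma> k) k" using True by (simp only:)
  from orbit_set_eq[OF permutation_reverse_cycle[OF assms] this] orbit_set_eq[OF assms True] k
  show ?thesis by (simp only:)
next
  case False
  show ?thesis by (simp only: support_reverse_cycle_other[OF assms False])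
qed

text \<open>Forward steps from \<open>k\<close> in one permutation are backward steps in the other,
  so exchanging the two directions gives the same map. This makes reversal an involution.\<close>

lemma cycle_reflection_reverse_cycle:
  assumes "permutation \<sigma>"
  shows "cycle_reflection (reverse_cycle \<sigma> k) k = cycle_reflection \<sigma> k"
proof
  fix x
  let ?\<tau> = "reverse_cycle \<sigma> k"
  have p: "permutation ?\<tau>" by (rule permutation_reverse_cycle[OF assms])
  show "cycle_reflection ?\<tau> k x = cycle_reflection \<sigma> k x"
  proof (cases "x \<in> orbit_set ?\<tau> k")
    case True
    then obtain i where x: "x = (?\<tau> ^^ i) k"
      by (rule in_orbit_setE[OF p])
    have "cycle_reflection ?\<tau> k x = cycle_reflection \<sigma> k ((inv' \<sigma> ^^ i) k)"
      by (simp only: x cycle_reflection_funpow[OF p] reverse_cycle_inv_funpow[OF assms]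
          cycle_reflection_self[OF assms])
    also have "(inv' \<sigma> ^^ i) k = x"
      by (simp only: x reverse_cycle_funpow[OF assms] cycle_reflection_self[OF assms]
          cycle_reflection_funpow[OF assms])
    finally show ?thesis .
  next
    case False
    moreover from False have "x \<notin> orbit_set \<sigma> k"
      unfolding orbit_set_reverse_cycle[OF assms] .
    ultimately show ?thesis by (metis cycle_reflection_outside)
  qed
qed

lemma reverse_cycle_involution:
  assumes "permutation \<sigma>"
  shows "reverse_cycle (reverse_cycle \<sigma> k) k = \<sigma>"
  unfolding reverse_cycle_def[of "reverse_cycle \<sigma> k"] cycle_reflection_reverse_cycle[OF assms]
  by (simp add: reverse_cycle_def fun_eq_iff cycle_reflection_involution[OF assms])

text \<open>Since \<open>\<sigma>\<close> is injective and commutes with its powers,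
  \<open>c\<close> and \<open>\<sigma> c\<close> have the same cycle length. Starting one step later
  only moves \<open>c\<close> to the end.\<close>

lemma support_image:
  assumes "permutation \<sigma>"
  shows "support \<sigma> (\<sigma> c) = rotate1 (support \<sigma> c)"
proof -
  have b: "bij \<sigma>" using assms by (rule permutation_bijective)
  have "(\<sigma> ^^ i) (\<sigma> c) = \<sigma> c \<longleftrightarrow> (\<sigma> ^^ i) c = c" for i
    by (metis b bij_inv_eq_iff funpow_swap1)
  hence lp: "least_power \<sigma> (\<sigma> c) = least_power \<sigma> c"
    by (simp add: least_power_def)
  obtain m where m: "least_power \<sigma> c = Suc m"
    using least_power_of_permutation(2)[OF assms, of c] gr0_conv_Suc by blast
  have "\<sigma> ((\<sigma> ^^ m) c) = c"
    using least_power_of_permutation(1)[OF assms, of c] m by simp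
  moreover have "support \<sigma> c = c # map (\<lambda>i. (\<sigma> ^^ Suc i) c) [0..<m]"
    unfolding m by (subst upt_conv_Cons) (simp_all only: map_Suc_upt[symmetric], simp_all)
  moreover have "support \<sigma> (\<sigma> c) = map (\<lambda>i. (\<sigma> ^^ Suc i) c) [0..<m] @ [\<sigma> ((\<sigma> ^^ m) c)]"
    unfolding lp m by (simp add: funpow_swap1)
  ultimately show ?thesis by simp
qed

section \<open>Characters\<close>

lemma mat_trace_mult_commute:
  assumes "X \<in> carrier_mat d d" and "Y \<in> carrier_mat d d"
  shows "mat_trace (X * Y) = mat_trace (Y * X)"
proof -
  have "mat_trace (X * Y) = (\<Sum>i<d. \<Sum>j<d. X $$ (i, j) * Y $$ (j, i))"
    using assms by (simp add: mat_trace_def scalar_prod_def lessThan_atLeast0)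
  also have "\<dots> = (\<Sum>j<d. \<Sum>i<d. X $$ (i, j) * Y $$ (j, i))"
    by (rule sum.swap)
  also have "\<dots> = mat_trace (Y * X)"
    using assms by (simp add: mat_trace_def scalar_prod_def lessThan_atLeast0 mult.commute)
  finally show ?thesis .
qed

text \<open>The hypothesis \<open>comm\<close> expresses that \<open>\<pi>\<close> conjugates
  \<open>\<sigma>\<close> to \<open>\<tau>\<close> without naming an inverse permutation. Cyclicity
  of the trace then gives the claim.\<close>

lemma sym_character_class_function:
  assumes "sym_character n \<chi>" and "\<sigma> permutes {1..n}" "\<tau> permutes {1..n}" "\<pi> permutes {1..n}"
    and comm: "\<tau> \<circ> \<pi> = \<pi> \<circ> \<sigma>"
  shows "\<chi> \<tau> = \<chi> \<sigma>"
proof -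
  let ?R = "\<lambda>d. ring_mat TYPE(complex) d ()"
  obtain d \<rho> where \<rho>: "\<rho> \<in> hom (sym_group n) (units_of (?R d))"
    and \<chi>: "\<And>\<sigma>. \<sigma> \<in> carrier (sym_group n) \<Longrightarrow> \<chi> \<sigma> = mat_trace (\<rho> \<sigma>)"
    using assms(1) unfolding sym_character_def by blast
  have mem: "\<sigma> \<in> carrier (sym_group n)" "\<tau> \<in> carrier (sym_group n)" "\<pi> \<in> carrier (sym_group n)"
    using assms by (simp_all add: sym_group_carrier)
  have units: "\<rho> x \<in> Units (?R d)" if "x \<in> carrier (sym_group n)" for x
    using hom_in_carrier[OF \<rho> that] by (simp add: units_of_def)
  have closed: "\<rho> x \<in> carrier_mat d d" if "x \<in> carrier (sym_group n)" for x
    using units[OF that] by (simp add: Units_def ring_mat_simps)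
  have mult: "\<rho> (x \<circ> y) = \<rho> x * \<rho> y"
    if "x \<in> carrier (sym_group n)" "y \<in> carrier (sym_group n)" for x y
    using hom_mult[OF \<rho> that] by (simp add: units_of_def sym_group_mult ring_mat_simps)
  \<comment> \<open>The inverse matrix comes from membership in the unit group, so
    \<open>\<rho>\<close> need not be evaluated at an inverse permutation.\<close>
  obtain V where V: "V \<in> carrier_mat d d" "V * \<rho> \<pi> = 1\<^sub>m d" "\<rho> \<pi> * V = 1\<^sub>m d"
    using units[OF mem(3)] by (auto simp: Units_def ring_mat_simps)
  note c = closed[OF mem(1)] closed[OF mem(2)] closed[OF mem(3)] V(1)
  have "mat_trace (\<rho> \<tau>) = mat_trace (\<rho> \<tau> * (\<rho> \<pi> * V))"
    using c by (simp add: V)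
  also have "\<rho> \<tau> * (\<rho> \<pi> * V) = \<rho> (\<tau> \<circ> \<pi>) * V"
    using c by (simp add: mult mem)
  also have "\<dots> = \<rho> \<pi> * (\<rho> \<sigma> * V)"
    using c unfolding comm by (simp add: mult mem)
  also have "mat_trace \<dots> = mat_trace (\<rho> \<sigma> * V * \<rho> \<pi>)"
    using c by (intro mat_trace_mult_commute[of _ d]) auto
  also have "\<rho> \<sigma> * V * \<rho> \<pi> = \<rho> \<sigma>"
    using c by (simp add: V assoc_mult_mat[of _ d d _ d _ d])
  finally show ?thesis by (simp add: \<chi> mem)
qed

lemma sym_character_reverse_cycle:
  assumes "sym_character n \<chi>" and "\<sigma> permutes {1..n}" and "k \<in> {1..n}"
  shows "\<chi> (reverse_cycle \<sigma> k) = \<chi> \<sigma>"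
proof (rule sym_character_class_function[OF assms(1,2)])
  have p: "permutation \<sigma>" using assms(2) permutation_permutes by blast
  show "reverse_cycle \<sigma> k permutes {1..n}" "cycle_reflection \<sigma> k permutes {1..n}"
    using assms by (simp_all only: reverse_cycle_permutes cycle_reflection_permutes finite_atLeastAtMost)
  show "reverse_cycle \<sigma> k \<circ> cycle_reflection \<sigma> k = cycle_reflection \<sigma> k \<circ> \<sigma>"
    by (simp add: fun_eq_iff reverse_cycle_def cycle_reflection_involution[OF p])
qed

section \<open>Cycle products of a Hermitian matrix\<close>

definition cycle_product :: "'f::field \<Rightarrow> 'f \<Rightarrow> 'f quat mat \<Rightarrow> (nat \<Rightarrow> nat) \<Rightarrow> nat \<Rightarrow> 'f quat" where
  "cycle_product a b A \<sigma> c = qprod a b (row_factors A (support \<sigma> c))"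

lemma row_factors_Cons:
  "row_factors A (c # cs) = map (\<lambda>(x, y). entry A x y) (zip (c # cs) (cs @ [c]))"
  by (simp add: row_factors_def)

lemma row_factors_rotate1: "row_factors A (rotate1 cs) = rotate1 (row_factors A cs)"
proof (cases cs)
  case (Cons x xs)
  show ?thesis
  proof (cases xs)
    case (Cons y ys)
    thus ?thesis
      using zip_append[of "y # ys" "ys @ [x]" "[x]" "[y]"]
      by (simp add: \<open>cs = x # xs\<close> row_factors_def)
  qed (simp add: Cons row_factors_def)
qed (simp add: row_factors_def)

text \<open>Pairing each element with its left neighbour after the rotation gives the same index
  pairs, in the same order, as pairing with the right neighbour before it. Row and column cycles
  thus have equal products.\<close>

lemma col_factors_rotate1: "col_factors A (rotate1 cs) = row_factors A cs"
  by (cases cs) (simp_all add: col_factors_def row_factors_def)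

lemma entry_conj:
  assumes "A \<in> carrier_mat n n" "quat_adjoint A = A" and "x \<in> {1..n}" "y \<in> {1..n}"
  shows "qconj (entry A x y) = entry A y x"
proof -
  have "entry A y x = quat_adjoint A $$ (y - 1, x - 1)"
    using assms(2) by (simp add: entry_def)
  also have "\<dots> = qconj (entry A x y)"
    using assms(1,3,4) by (auto simp: quat_adjoint_def entry_def)
  finally show ?thesis by simp
qed

text \<open>Conjugation reverses the order of the factors, and the Hermitian property swaps the two
  indices of each. Together they traverse the closed walk from \<open>c\<close> backwards.\<close>

lemma qconj_qprod_row_factors:
  assumes "A \<in> carrier_mat n n" "quat_adjoint A = A" and "set (c # cs) \<subseteq> {1..n}"
  shows "qconj (qprod a b (row_factors A (c # cs))) = qprod a b (row_factors A (c # rev cs))"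
proof -
  have "map qconj (row_factors A (c # cs)) =
      map (\<lambda>(x, y). entry A y x) (zip (c # cs) (cs @ [c]))"
    unfolding row_factors_Cons map_map
  proof (rule map_cong[OF refl], clarify)
    fix x y assume "(x, y) \<in> set (zip (c # cs) (cs @ [c]))"
    hence "x \<in> set (c # cs)" "y \<in> set (cs @ [c])"
      by (rule set_zip_leftD set_zip_rightD)+
    hence "x \<in> {1..n}" "y \<in> {1..n}" using assms(3) by auto
    thus "(qconj \<circ> (\<lambda>(x, y). entry A x y)) (x, y) = entry A y x"
      by (simp add: entry_conj[OF assms(1,2)])
  qed
  also have "\<dots> = map (\<lambda>(x, y). entry A x y) (zip (cs @ [c]) (c # cs))"
    by (subst zip_commute) (simp add: case_prod_unfold)
  also have "rev \<dots> = row_factors A (c # rev cs)"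
    unfolding row_factors_Cons rev_map by (simp add: zip_rev[symmetric] del: zip_append)
  finally show ?thesis by (simp only: qconj_qprod)
qed

lemma cycle_product_reverse_cycle:
  assumes "A \<in> carrier_mat n n" "quat_adjoint A = A" and "\<sigma> permutes {1..n}" and "k \<in> {1..n}"
  shows "cycle_product a b A (reverse_cycle \<sigma> k) k = qconj (cycle_product a b A \<sigma> k)"
proof -
  have p: "permutation \<sigma>" using assms(3) permutation_permutes by blast
  have s: "support \<sigma> k = k # tl (support \<sigma> k)"
    by (rule support_eq_Cons[OF p])
  have "set (k # tl (support \<sigma> k)) \<subseteq> {1..n}"
    using orbit_set_subset[OF assms(3,4)] s by metis
  from qconj_qprod_row_factors[OF assms(1,2) this] show ?thesis
    unfolding cycle_product_def support_reverse_cycle_self[OF p] s[symmetric] by (rule sym)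
qed

text \<open>Each step along the cycle rotates the list of factors, which the scalar part does not
  notice.\<close>

lemma q0_cycle_product_orbit:
  assumes "permutation \<sigma>" and "x \<in> orbit_set \<sigma> c"
  shows "q0 (cycle_product a b A \<sigma> x) = q0 (cycle_product a b A \<sigma> c)"
proof -
  have "q0 (cycle_product a b A \<sigma> ((\<sigma> ^^ i) c)) = q0 (cycle_product a b A \<sigma> c)" for i
    by (induction i)
      (simp_all only: funpow.simps comp_apply id_apply cycle_product_def support_image[OF assms(1)]
        row_factors_rotate1 q0_qprod_rotate1)
  thus ?thesis using assms by (metis in_orbit_setE)
qed

section \<open>Replacing cycle products by their scalar parts\<close>

text \<open>Interpolates between the immanant summand, for empty \<open>S\<close>, and a product of
  scalars, once \<open>S\<close> contains all of \<open>cs\<close>. The set \<open>S\<close> records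
  the leaders already treated.\<close>

definition partial_product ::
  "'f::field \<Rightarrow> 'f \<Rightarrow> 'f quat mat \<Rightarrow> nat set \<Rightarrow> nat list \<Rightarrow> (nat \<Rightarrow> nat) \<Rightarrow> 'f quat" where
  "partial_product a b A S cs \<sigma> = qprod a b (map (\<lambda>c. if c \<in> S
     then of_field (q0 (cycle_product a b A \<sigma> c)) else cycle_product a b A \<sigma> c) cs)"

text \<open>At most one point is taken from each cycle, so reversing the cycle of one listed point
  alters just one factor. The order of the list is free, to serve both rows and columns.\<close>

definition cycle_transversal :: "nat \<Rightarrow> (nat \<Rightarrow> nat) \<Rightarrow> nat list \<Rightarrow> bool" where
  "cycle_transversal n \<sigma> cs \<longleftrightarrow> distinct cs \<and> set cs \<subseteq> {1..n} \<and>
     (\<forall>c\<in>set cs. \<forall>d\<in>set cs. d \<in> orbit_set \<sigma> c \<longrightarrow> d = c)"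

text \<open>The two products on the left differ only in the factor at \<open>k\<close>, where they
  carry conjugate values. By distributivity their sum carries the trace there, which is twice the
  scalar part.\<close>

lemma partial_product_reverse_cycle:
  assumes A: "A \<in> carrier_mat n n" "quat_adjoint A = A"
    and \<sigma>: "\<sigma> permutes {1..n}" and cs: "cycle_transversal n \<sigma> cs" and k: "k \<notin> S" "k \<in> set cs"
  shows "partial_product a b A S cs \<sigma> + partial_product a b A S cs (reverse_cycle \<sigma> k)
    = partial_product a b A (insert k S) cs \<sigma> + partial_product a b A (insert k S) cs (reverse_cycle \<sigma> k)"
proof -
  have p: "permutation \<sigma>" using \<sigma> permutation_permutes by blast
  obtain us vs where cs_eq: "cs = us @ k # vs" using k(2) split_list by metis
  have kn: "k \<in> {1..n}" using cs k unfolding cycle_transversal_def by blast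
  have ne: "c \<noteq> k \<and> cycle_product a b A (reverse_cycle \<sigma> k) c = cycle_product a b A \<sigma> c"
    if "c \<in> set us \<union> set vs" for c
  proof
    show "c \<noteq> k" using that cs cs_eq unfolding cycle_transversal_def by auto
    moreover have "c \<in> set cs" using that cs_eq by auto
    ultimately have "c \<notin> orbit_set \<sigma> k"
      using cs k(2) unfolding cycle_transversal_def by blast
    from support_reverse_cycle_other[OF p this]
    show "cycle_product a b A (reverse_cycle \<sigma> k) c = cycle_product a b A \<sigma> c"
      by (simp only: cycle_product_def)
  qed
  let ?P = "cycle_product a b A \<sigma>"
  let ?f = "\<lambda>c. if c \<in> S then of_field (q0 (?P c)) else ?P c"
  let ?U = "qprod a b (map ?f us)" and ?V = "qprod a b (map ?f vs)"
  \<comment> \<open>Any choice of factors agreeing with \<open>?f\<close> away from \<open>k\<close>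
    has the same surroundings \<open>?U\<close> and \<open>?V\<close>. All four products are brought
    to this form.\<close>
  have expand: "qprod a b (map g cs) = qmult a b ?U (qmult a b (g k) ?V)"
    if "\<And>c. c \<in> set us \<union> set vs \<Longrightarrow> g c = ?f c" for g
  proof -
    have "map g us = map ?f us" "map g vs = map ?f vs" using that by simp_all
    thus ?thesis by (simp only: cs_eq qprod_append qprod_Cons map_append list.map)
  qed
  have rk: "cycle_product a b A (reverse_cycle \<sigma> k) k = qconj (?P k)"
    by (rule cycle_product_reverse_cycle[OF A \<sigma> kn])
  have P: "partial_product a b A S cs \<sigma> = qmult a b ?U (qmult a b (?P k) ?V)"
    unfolding partial_product_def by (rule trans[OF expand]) (simp_all add: k(1))
  have P': "partial_product a b A S cs (reverse_cycle \<sigma> k) = qmult a b ?U (qmult a b (qconj (?P k)) ?V)"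
    unfolding partial_product_def by (rule trans[OF expand]) (simp_all add: k(1) ne rk)
  have Q: "partial_product a b A (insert k S) cs \<sigma>
      = qmult a b ?U (qmult a b (of_field (q0 (?P k))) ?V)"
    unfolding partial_product_def by (rule trans[OF expand]) (simp_all add: ne)
  have Q': "partial_product a b A (insert k S) cs (reverse_cycle \<sigma> k)
      = qmult a b ?U (qmult a b (of_field (q0 (?P k))) ?V)"
    unfolding partial_product_def by (rule trans[OF expand]) (simp_all add: ne rk)
  have add: "qmult a b ?U (qmult a b x ?V) + qmult a b ?U (qmult a b y ?V)
      = qmult a b ?U (qmult a b (x + y) ?V)" for x y
    by (simp only: qmult_add_distrib)
  show ?thesis
    by (simp only: P P' Q Q' add) (simp only: add_qconj)
qed

text \<open>Pairing \<open>\<sigma>\<close> with the permutation in which the cycle of \<open>k\<close> is reversed shows that the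
  difference of the two sums below equals its own negative.\<close>

lemma sum_partial_product_insert:
  fixes w :: "(nat \<Rightarrow> nat) \<Rightarrow> 'f::field"
  assumes two: "(2::'f) \<noteq> 0"
    and A: "A \<in> carrier_mat n n" "quat_adjoint A = A"
    and w: "\<And>\<sigma>. \<sigma> permutes {1..n} \<Longrightarrow> w (reverse_cycle \<sigma> k) = w \<sigma>"
    and ls: "\<And>\<sigma>. \<sigma> permutes {1..n} \<Longrightarrow> cycle_transversal n \<sigma> (ls \<sigma>)"
      "\<And>\<sigma>. \<sigma> permutes {1..n} \<Longrightarrow> ls (reverse_cycle \<sigma> k) = ls \<sigma>"
    and k: "k \<in> {1..n}" "k \<notin> S"
  shows "(\<Sum>\<sigma> | \<sigma> permutes {1..n}. qmult a b (of_field (w \<sigma>)) (partial_product a b A S (ls \<sigma>) \<sigma>))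
    = (\<Sum>\<sigma> | \<sigma> permutes {1..n}.
        qmult a b (of_field (w \<sigma>)) (partial_product a b A (insert k S) (ls \<sigma>) \<sigma>))"
    (is "sum ?f ?G = sum ?g ?G")
proof -
  have pair: "?f \<sigma> + ?f (reverse_cycle \<sigma> k) = ?g \<sigma> + ?g (reverse_cycle \<sigma> k)" if "\<sigma> \<in> ?G" for \<sigma>
  proof -
    have \<sigma>: "\<sigma> permutes {1..n}" using that by simp
    have "partial_product a b A S (ls \<sigma>) \<sigma> + partial_product a b A S (ls \<sigma>) (reverse_cycle \<sigma> k)
      = partial_product a b A (insert k S) (ls \<sigma>) \<sigma>
        + partial_product a b A (insert k S) (ls \<sigma>) (reverse_cycle \<sigma> k)"
    proof (cases "k \<in> set (ls \<sigma>)")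
      case True
      thus ?thesis by (intro partial_product_reverse_cycle[OF A \<sigma> ls(1)[OF \<sigma>] k(2)])
    next
      case False
      \<comment> \<open>If \<open>k\<close> is not a chosen leader, \<open>S\<close> and
        \<open>insert k S\<close> select the same factors.\<close>
      have "partial_product a b A (insert k S) (ls \<sigma>) \<tau> = partial_product a b A S (ls \<sigma>) \<tau>" for \<tau>
        unfolding partial_product_def using False
        by (intro arg_cong[where f = "qprod a b"] map_cong) auto
      thus ?thesis by simp
    qed
    from arg_cong[where f = "qmult a b (of_field (w \<sigma>))", OF this] show ?thesis
      unfolding w[OF \<sigma>] ls(2)[OF \<sigma>] qmult_add_distrib(1) .
  qed
  have p: "permutation \<sigma>" if "\<sigma> \<in> ?G" for \<sigma>
    using that permutation_permutes by blast
  have inv: "\<forall>\<sigma>\<in>?G. reverse_cycle (reverse_cycle \<sigma> k) k = \<sigma>"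
    using reverse_cycle_involution[OF p] by blast
  have img: "(\<lambda>\<sigma>. reverse_cycle \<sigma> k) ` ?G \<subseteq> ?G"
    using reverse_cycle_permutes[OF _ finite_atLeastAtMost k(1)] by blast
  have bij: "bij_betw (\<lambda>\<sigma>. reverse_cycle \<sigma> k) ?G ?G"
    by (rule bij_betw_byWitness[OF inv inv img img])
  \<comment> \<open>Summing over all permutations, instead of over pairs, also handles those fixed
    by the reversal, where the cycle of \<open>k\<close> has length one or two.\<close>
  have double: "(\<Sum>\<sigma>\<in>?G. h \<sigma> + h (reverse_cycle \<sigma> k)) = sum h ?G + sum h ?G"
    for h :: "(nat \<Rightarrow> nat) \<Rightarrow> 'f quat"
    using sum.reindex_bij_betw[OF bij, of h] by (simp add: sum.distrib)
  have "(\<Sum>\<sigma>\<in>?G. ?f \<sigma> + ?f (reverse_cycle \<sigma> k)) = (\<Sum>\<sigma>\<in>?G. ?g \<sigma> + ?g (reverse_cycle \<sigma> k))"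
    by (rule sum.cong[OF refl]) (rule pair)
  hence "sum ?f ?G + sum ?f ?G = sum ?g ?G + sum ?g ?G"
    using double[of ?f] double[of ?g] by metis
  hence "(sum ?f ?G - sum ?g ?G) + (sum ?f ?G - sum ?g ?G) = 0"
    by (simp add: algebra_simps)
  from quat_double_eq_0[OF two this] show ?thesis
    by (simp only: right_minus_eq)
qed

text \<open>Starting from the empty set, \<open>S\<close> grows by one index at a time to
  \<open>{1..n}\<close> without changing the sum. All factors are then scalars, so the ordered
  product becomes a product over a set.\<close>

lemma sum_cycle_products:
  fixes w :: "(nat \<Rightarrow> nat) \<Rightarrow> 'f::field"
  assumes two: "(2::'f) \<noteq> 0"
    and A: "A \<in> carrier_mat n n" "quat_adjoint A = A"
    and w: "\<And>\<sigma> k. \<sigma> permutes {1..n} \<Longrightarrow> k \<in> {1..n} \<Longrightarrow> w (reverse_cycle \<sigma> k) = w \<sigma>"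
    and ls: "\<And>\<sigma>. \<sigma> permutes {1..n} \<Longrightarrow> cycle_transversal n \<sigma> (ls \<sigma>)"
      "\<And>\<sigma> k. \<sigma> permutes {1..n} \<Longrightarrow> ls (reverse_cycle \<sigma> k) = ls \<sigma>"
  shows "(\<Sum>\<sigma> | \<sigma> permutes {1..n}.
      qmult a b (of_field (w \<sigma>)) (qprod a b (map (cycle_product a b A \<sigma>) (ls \<sigma>))))
    = of_field (\<Sum>\<sigma> | \<sigma> permutes {1..n}.
        w \<sigma> * (\<Prod>c\<in>set (ls \<sigma>). q0 (cycle_product a b A \<sigma> c)))"
proof -
  let ?sum = "\<lambda>S. \<Sum>\<sigma> | \<sigma> permutes {1..n}.
    qmult a b (of_field (w \<sigma>)) (partial_product a b A S (ls \<sigma>) \<sigma>)"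
  have "?sum {} = ?sum S" if "finite S" "S \<subseteq> {1..n}" for S
    using that
  proof (induction S rule: finite_induct)
    case (insert k S)
    hence "k \<in> {1..n}" "k \<notin> S" by auto
    hence "?sum S = ?sum (insert k S)"
      by (intro sum_partial_product_insert[where ls = ls, OF two A] w ls) assumption+
    thus ?case using insert by simp
  qed simp
  hence "?sum {} = ?sum {1..n}" by simp
  also have "\<dots> = of_field (\<Sum>\<sigma> | \<sigma> permutes {1..n}.
        w \<sigma> * (\<Prod>c\<in>set (ls \<sigma>). q0 (cycle_product a b A \<sigma> c)))"
    unfolding of_field_sum
  proof (rule sum.cong[OF refl])
    fix \<sigma> assume "\<sigma> \<in> {\<sigma>. \<sigma> permutes {1..n}}"
    hence t: "distinct (ls \<sigma>)" "set (ls \<sigma>) \<subseteq> {1..n}"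
      using ls(1) unfolding cycle_transversal_def by auto
    have "partial_product a b A {1..n} (ls \<sigma>) \<sigma>
      = qprod a b (map (\<lambda>c. of_field (q0 (cycle_product a b A \<sigma> c))) (ls \<sigma>))"
      unfolding partial_product_def using t(2)
      by (intro arg_cong[where f = "qprod a b"] map_cong) auto
    also have "\<dots> = of_field (\<Prod>c\<in>set (ls \<sigma>). q0 (cycle_product a b A \<sigma> c))"
      by (simp only: qprod_of_field prod.distinct_set_conv_list[OF t(1)])
    finally show "qmult a b (of_field (w \<sigma>)) (partial_product a b A {1..n} (ls \<sigma>) \<sigma>)
      = of_field (w \<sigma> * (\<Prod>c\<in>set (ls \<sigma>). q0 (cycle_product a b A \<sigma> c)))"
      by (simp only: of_field_mult[of _ _ a b])
  qed
  finally show ?thesis by (simp add: partial_product_def)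
qed

section \<open>Immanants\<close>

text \<open>A choice of one leader per cycle that does not involve the row or column index; all
  immanants are compared through it.\<close>

definition cycle_minima :: "nat \<Rightarrow> (nat \<Rightarrow> nat) \<Rightarrow> nat set" where
  "cycle_minima n \<sigma> = {c \<in> {1..n}. \<forall>d\<in>orbit_set \<sigma> c. c \<le> d}"

lemma set_other_leaders:
  "set (other_leaders n i \<sigma>) = {c \<in> cycle_minima n \<sigma>. c \<notin> orbit_set \<sigma> i}"
  by (auto simp: other_leaders_def cycle_minima_def)

lemma other_leaders_reverse_cycle:
  assumes "permutation \<sigma>"
  shows "other_leaders n i (reverse_cycle \<sigma> k) = other_leaders n i \<sigma>"
  unfolding other_leaders_def orbit_set_reverse_cycle[OF assms] ..

lemma cycle_minima_unique:
  assumes "permutation \<sigma>" "c \<in> cycle_minima n \<sigma>" "d \<in> cycle_minima n \<sigma>" "d \<in> orbit_set \<sigma> c"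
  shows "d = c"
proof (rule antisym)
  show "c \<le> d" using assms(2,4) unfolding cycle_minima_def by blast
  show "d \<le> c" using assms(3) orbit_set_sym[OF assms(1,4)] unfolding cycle_minima_def by blast
qed

lemma cycle_transversal_leaders:
  assumes \<sigma>: "\<sigma> permutes {1..n}" and i: "i \<in> {1..n}"
    and cs: "distinct cs" "set cs = insert i (set (other_leaders n i \<sigma>))"
  shows "cycle_transversal n \<sigma> cs"
  unfolding cycle_transversal_def
proof (intro conjI ballI impI)
  have p: "permutation \<sigma>" using \<sigma> permutation_permutes by blast
  show "set cs \<subseteq> {1..n}"
    using i by (auto simp: cs(2) set_other_leaders cycle_minima_def simp del: set_map)
  fix c d assume *: "c \<in> set cs" "d \<in> set cs" "d \<in> orbit_set \<sigma> c"
  show "d = c"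
    using * cycle_minima_unique[OF p, of c n d] orbit_set_sym[OF p *(3)]
    unfolding cs(2) set_other_leaders by blast
qed (rule cs(1))

text \<open>The leaders differ from the cycle minima only in that \<open>i\<close> stands for the
  minimum of its own cycle. As \<open>h\<close> is constant on cycles, the exchange is
  harmless.\<close>

lemma prod_leaders:
  assumes \<sigma>: "\<sigma> permutes {1..n}" and i: "i \<in> {1..n}"
    and h: "\<And>x c. x \<in> orbit_set \<sigma> c \<Longrightarrow> h x = h c"
  shows "prod h (insert i (set (other_leaders n i \<sigma>))) = prod h (cycle_minima n \<sigma>)"
proof -
  have p: "permutation \<sigma>" using \<sigma> permutation_permutes by blast
  let ?O = "orbit_set \<sigma> i" and ?L = "set (other_leaders n i \<sigma>)"
  define m where "m = Min ?O"
  have i_in: "i \<in> ?O" by (rule self_in_orbit_set[OF p])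
  hence m_in: "m \<in> ?O" unfolding m_def by (metis Min_in empty_iff finite_set)
  have "m \<le> d" if "d \<in> ?O" for d
    unfolding m_def using that by (intro Min_le finite_set)
  moreover have "m \<in> {1..n}" using m_in orbit_set_subset[OF \<sigma> i] by blast
  ultimately have m_min: "m \<in> cycle_minima n \<sigma>"
    unfolding cycle_minima_def using orbit_set_eq[OF p m_in] by blast
  have eq: "cycle_minima n \<sigma> = insert m ?L"
    using m_min m_in cycle_minima_unique[OF p m_min] orbit_set_eq[OF p m_in]
    unfolding set_other_leaders by blast
  have "i \<notin> ?L" "m \<notin> ?L" using i_in m_in unfolding set_other_leaders by blast+
  thus ?thesis unfolding eq using h[OF m_in] by (simp del: set_map)
qed

text \<open>The list \<open>ls\<close> may arrange the leaders in any order fixed under reversal,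
  and the right-hand side mentions neither \<open>i\<close> nor \<open>ls\<close>. This covers rows
  and columns at once.\<close>

lemma sum_leader_products:
  fixes a b :: "'f::field" and w :: "(nat \<Rightarrow> nat) \<Rightarrow> 'f"
  assumes two: "(2::'f) \<noteq> 0"
    and A: "A \<in> carrier_mat n n" "quat_adjoint A = A"
    and w: "\<And>\<sigma> k. \<sigma> permutes {1..n} \<Longrightarrow> k \<in> {1..n} \<Longrightarrow> w (reverse_cycle \<sigma> k) = w \<sigma>"
    and i: "i \<in> {1..n}"
    and ls: "\<And>\<sigma>. \<sigma> permutes {1..n} \<Longrightarrow> distinct (ls \<sigma>)"
      "\<And>\<sigma>. \<sigma> permutes {1..n} \<Longrightarrow> set (ls \<sigma>) = insert i (set (other_leaders n i \<sigma>))"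
      "\<And>\<sigma> k. \<sigma> permutes {1..n} \<Longrightarrow> ls (reverse_cycle \<sigma> k) = ls \<sigma>"
  shows "(\<Sum>\<sigma> | \<sigma> permutes {1..n}.
      qmult a b (of_field (w \<sigma>)) (qprod a b (map (cycle_product a b A \<sigma>) (ls \<sigma>))))
    = of_field (\<Sum>\<sigma> | \<sigma> permutes {1..n}.
        w \<sigma> * (\<Prod>c\<in>cycle_minima n \<sigma>. q0 (cycle_product a b A \<sigma> c)))"
proof -
  have "cycle_transversal n \<sigma> (ls \<sigma>)" if "\<sigma> permutes {1..n}" for \<sigma>
    by (rule cycle_transversal_leaders[OF that i ls(1,2)[OF that]])
  note sum_cycle_products[where w = w and ls = ls, OF two A w this ls(3)]
  also have "(\<Sum>\<sigma> | \<sigma> permutes {1..n}.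
        w \<sigma> * (\<Prod>c\<in>set (ls \<sigma>). q0 (cycle_product a b A \<sigma> c)))
    = (\<Sum>\<sigma> | \<sigma> permutes {1..n}.
        w \<sigma> * (\<Prod>c\<in>cycle_minima n \<sigma>. q0 (cycle_product a b A \<sigma> c)))"
  proof (rule sum.cong[OF refl])
    fix \<sigma> assume "\<sigma> \<in> {\<sigma>. \<sigma> permutes {1..n}}"
    hence \<sigma>: "\<sigma> permutes {1..n}" by simp
    hence p: "permutation \<sigma>" using permutation_permutes by blast
    show "w \<sigma> * (\<Prod>c\<in>set (ls \<sigma>). q0 (cycle_product a b A \<sigma> c))
      = w \<sigma> * (\<Prod>c\<in>cycle_minima n \<sigma>. q0 (cycle_product a b A \<sigma> c))"
      unfolding ls(2)[OF \<sigma>]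
      by (rule arg_cong[OF prod_leaders[OF \<sigma> i]]) (rule q0_cycle_product_orbit[OF p])
  qed
  finally show ?thesis .
qed

theorem theorem5p1:
  fixes a b :: "'f::field"
    and n :: nat
    and \<chi> :: "(nat \<Rightarrow> nat) \<Rightarrow> complex"
    and A :: "'f quat mat"
  assumes "quaternion_algebra a b"
    and "n \<ge> 1"
    and "sym_character n \<chi>"
    and "A \<in> carrier_mat n n"
    and "quat_adjoint A = A"
  shows "\<exists>c::'f. (\<forall>i\<in>{1..n}. rImm a b \<chi> i A = of_field c)
    \<and> (\<forall>j\<in>{1..n}. cImm a b \<chi> j A = of_field c)"
proof -
  let ?w = "\<lambda>\<sigma>. int_to_field (\<chi> \<sigma>) :: 'f"
  let ?c = "\<Sum>\<sigma> | \<sigma> permutes {1..n}.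
    ?w \<sigma> * (\<Prod>c\<in>cycle_minima n \<sigma>. q0 (cycle_product a b A \<sigma> c))"
  have two: "(2::'f) \<noteq> 0" using assms(1) quaternion_algebra_iff by blast
  have dim: "dim_row A = n" "carrier (sym_group n) = {\<sigma>. \<sigma> permutes {1..n}}"
    using assms(4) by (auto simp: sym_group_def)
  have w: "?w (reverse_cycle \<sigma> k) = ?w \<sigma>" if "\<sigma> permutes {1..n}" "k \<in> {1..n}" for \<sigma> k
    using sym_character_reverse_cycle[OF assms(3) that] by simp
  have ol: "other_leaders n i (reverse_cycle \<sigma> k) = other_leaders n i \<sigma>"
    if "\<sigma> permutes {1..n}" for \<sigma> i k
    using that permutation_permutes by (intro other_leaders_reverse_cycle) blast
  have dist: "distinct (other_leaders n i \<sigma>)" for i \<sigma>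
    by (simp add: other_leaders_def)
  have notin: "i \<notin> set (other_leaders n i \<sigma>)" if "\<sigma> permutes {1..n}" for i \<sigma>
  proof -
    have "i \<in> orbit_set \<sigma> i"
      using that permutation_permutes by (intro self_in_orbit_set) blast
    thus ?thesis unfolding set_other_leaders by blast
  qed
  have cycle_product_eta: "cycle_product a b A \<sigma> = (\<lambda>c. qprod a b (row_factors A (support \<sigma> c)))" for \<sigma>
    by (rule ext) (rule cycle_product_def)
  have row: "qprod a b (concat (map (row_factors A) (left_ordered n i \<sigma>)))
      = qprod a b (map (cycle_product a b A \<sigma>) (i # other_leaders n i \<sigma>))" for i \<sigma>
    by (simp only: qprod_concat left_ordered_def list.map map_map comp_def cycle_product_eta)
  \<comment> \<open>In the right-ordered form the remaining leaders appear in decreasing order and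
    \<open>i\<close> comes last.\<close>
  have col: "qprod a b (concat (map (col_factors A) (right_ordered n i \<sigma>)))
      = qprod a b (map (cycle_product a b A \<sigma>) (rev (other_leaders n i \<sigma>) @ [i]))" for i \<sigma>
    by (simp only: qprod_concat right_ordered_def list.map map_append map_map comp_def
        col_factors_rotate1 cycle_product_eta)
  note leader_products = sum_leader_products[where w = ?w, OF two assms(4,5) w]
  have "rImm a b \<chi> i A = of_field ?c" if i: "i \<in> {1..n}" for i
    unfolding rImm_def dim row
    by (rule leader_products[where ls = "\<lambda>\<sigma>. i # other_leaders n i \<sigma>", OF _ _ i])
      (simp_all add: notin dist ol)
  moreover have "cImm a b \<chi> i A = of_field ?c" if i: "i \<in> {1..n}" for i
    unfolding cImm_def dim col
    by (rule leader_products[where ls = "\<lambda>\<sigma>. rev (other_leaders n i \<sigma>) @ [i]", OF _ _ i])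
      (simp_all add: notin dist ol)
  ultimately show ?thesis by blast
qed

end
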